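(* Let $M_1$ and $M_2$ be matroids on disjoint finite sets. The $\mathcal{G}$-invariant of the direct sum $M_1\oplus M_2$ is given by $$\mathcal{G}(M_1\oplus M_2)=\mathcal{G}(M_1)\wr\mathcal{G}(M_2),$$ where $\wr$ denotes the shuffle product.
   Context: An $(n,r)$-sequence is a $0,1$-sequence of length $n$ with exactly $r$ ones. $\mathcal{G}(n,r)$ is the vector space over a field of characteristic zero with basis the formal symbols $[\underline{r}]$, one for each $(n,r)$-sequence $\underline{r}$. For a rank-$r$ matroid $M$ with rank function $r(\cdot)$ on an $n$-element set $E$, and a permutation (linear ordering) $\pi$ of $E$, the rank sequence $\underline{r}(\pi)=r_1r_2\ldots r_n$ is given by $r_1=r(\{\pi(1)\})$ and $r_j=r(\{\pi(1),\ldots,\pi(j)\})-r(\{\pi(1),\ldots,\pi(j-1)\})$ for $j\ge2$. The $\mathcal{G}$-invariant is $\mathcal{G}(M)=\sum_{\pi}[\underline{r}(\pi)]\in\mathcal{G}(n,r)$, the sum over all $n!$ permutations of $E$. For sequences $(\alpha_1,\ldots,\alpha_m)$ and $(\beta_1,\ldots,\beta_n)$ and an $m$-element subset $P$ of $\{1,\ldots,m+n\}$, the shuffle $\mathrm{sh}((\alpha_i),(\beta_j);P)$ is the sequence of length $m+n$ obtained by inserting $(\alpha_i)$, in order, into the positions in $P$ and $(\beta_j)$, in order, into the remaining positions. For symbols $[\underline{r}]\in\mathcal{G}(n_1,r_1)$ and $[\underline{s}]\in\mathcal{G}(n_2,r_2)$, the shuffle product is $$[\underline{r}]\wr[\underline{s}]=\sum_{P\subseteq\{1,\ldots,n_1+n_2\},\,|P|=n_1}[\mathrm{sh}(\underline{r},\underline{s};P)]\in\mathcal{G}(n_1+n_2,r_1+r_2),$$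 extended bilinearly to $\mathcal{G}(n_1,r_1)\times\mathcal{G}(n_2,r_2)$. *)

theory Defs
  imports "HOL-Library.Poly_Mapping" "HOL-Combinatorics.Multiset_Permutations"
begin

record 'a matroid =
  ground :: "'a set"
  indep :: "'a set \<Rightarrow> bool"

definition is_matroid :: "'a matroid \<Rightarrow> bool" where
  "is_matroid M \<longleftrightarrow>
     finite (ground M) \<and>
     (\<forall>X. indep M X \<longrightarrow> X \<subseteq> ground M) \<and>
     indep M {} \<and>
     (\<forall>X Y. indep M X \<and> Y \<subseteq> X \<longrightarrow> indep M Y) \<and>
     (\<forall>X Y. indep M X \<and> indep M Y \<and> card X < card Y \<longrightarrow> (\<exists>x\<in>Y - X. indep M (insert x X)))"

definition rank_of :: "'a matroid \<Rightarrow> 'a set \<Rightarrow> nat" where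
  "rank_of M X = Max {card Y |Y. Y \<subseteq> X \<and> indep M Y}"

definition rank :: "'a matroid \<Rightarrow> nat" where
  "rank M = rank_of M (ground M)"

definition direct_sum :: "'a matroid \<Rightarrow> 'a matroid \<Rightarrow> 'a matroid" (infixl "\<oplus>\<^sub>M" 65) where
  "M1 \<oplus>\<^sub>M M2 =
     \<lparr>ground = ground M1 \<union> ground M2,
      indep = (\<lambda>X. \<exists>X1 X2. indep M1 X1 \<and> indep M2 X2 \<and> X = X1 \<union> X2)\<rparr>"

definition nr_sequences :: "nat \<Rightarrow> nat \<Rightarrow> nat list set" where
  "nr_sequences n r = {xs. length xs = n \<and> set xs \<subseteq> {0, 1} \<and> count_list xs 1 = r}"

text \<open>All the spaces \<open>\<G>(n,r)\<close> are subspaces of one ambient space, the finitely supported functions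
  from lists to the field: \<open>\<G>(n,r)\<close> consists of those supported on the \<open>(n,r)\<close>-sequences.\<close>

definition G_space :: "nat \<Rightarrow> nat \<Rightarrow> (nat list \<Rightarrow>\<^sub>0 'k::field_char_0) set" where
  "G_space n r = {f. Poly_Mapping.keys f \<subseteq> nr_sequences n r}"

definition symb :: "nat list \<Rightarrow> (nat list \<Rightarrow>\<^sub>0 'k::field_char_0)" where
  "symb xs = Poly_Mapping.single xs 1"

definition scale :: "'k::field_char_0 \<Rightarrow> (nat list \<Rightarrow>\<^sub>0 'k) \<Rightarrow> (nat list \<Rightarrow>\<^sub>0 'k)" where
  "scale c f = Poly_Mapping.map (\<lambda>x. c * x) f"

text \<open>A permutation \<open>\<pi>\<close> of the ground set is a list enumerating it without repetition, so that
  \<open>\<pi>(j)\<close> is \<open>\<pi> ! (j - 1)\<close> and \<open>{\<pi>(1), \<dots>, \<pi>(j)}\<close> is \<open>set (take j \<pi>)\<close>. The truncated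
  subtraction is harmless since the rank function is monotone.\<close>

definition rank_sequence :: "'a matroid \<Rightarrow> 'a list \<Rightarrow> nat list" where
  "rank_sequence M \<pi> =
     map (\<lambda>j. if j = 1 then rank_of M {\<pi> ! 0}
              else rank_of M (set (take j \<pi>)) - rank_of M (set (take (j - 1) \<pi>)))
       [1..<length \<pi> + 1]"

definition G_invariant :: "'a matroid \<Rightarrow> (nat list \<Rightarrow>\<^sub>0 'k::field_char_0)" where
  "G_invariant M = (\<Sum>\<pi>\<in>permutations_of_set (ground M). symb (rank_sequence M \<pi>))"

definition sh :: "'b list \<Rightarrow> 'b list \<Rightarrow> nat set \<Rightarrow> 'b list" where
  "sh xs ys P =
     map (\<lambda>i. if i \<in> P then xs ! card {j \<in> P. j < i} else ys ! card {j \<in> {1..<i}. j \<notin> P})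
       [1..<length xs + length ys + 1]"

definition shuffle_symb :: "nat list \<Rightarrow> nat list \<Rightarrow> (nat list \<Rightarrow>\<^sub>0 'k::field_char_0)" where
  "shuffle_symb xs ys =
     (\<Sum>P | P \<subseteq> {1..length xs + length ys} \<and> card P = length xs. symb (sh xs ys P))"

definition shuffle_product ::
  "(nat list \<Rightarrow>\<^sub>0 'k::field_char_0) \<Rightarrow> (nat list \<Rightarrow>\<^sub>0 'k) \<Rightarrow> (nat list \<Rightarrow>\<^sub>0 'k)" (infixl "\<wr>" 70) where
  "f \<wr> g = (\<Sum>xs\<in>Poly_Mapping.keys f. \<Sum>ys\<in>Poly_Mapping.keys g.
     scale (Poly_Mapping.lookup f xs * Poly_Mapping.lookup g ys) (shuffle_symb xs ys))"


lemma lookup_scale [simp]: "Poly_Mapping.lookup (scale c f) x = c * Poly_Mapping.lookup f x"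
  by (simp add: scale_def map.rep_eq when_def)

lemma shuffle_product_symb: "symb xs \<wr> symb ys = shuffle_symb xs ys"
  by (rule poly_mapping_eqI) (simp add: shuffle_product_def symb_def)

lemma shuffle_product_superset:
  assumes "finite A" "finite B" "Poly_Mapping.keys f \<subseteq> A" "Poly_Mapping.keys g \<subseteq> B"
  shows "f \<wr> g = (\<Sum>xs\<in>A. \<Sum>ys\<in>B.
     scale (Poly_Mapping.lookup f xs * Poly_Mapping.lookup g ys) (shuffle_symb xs ys))"
proof -
  have z: "scale 0 h = 0" for h :: "nat list \<Rightarrow>\<^sub>0 'a"
    by (rule poly_mapping_eqI) simp
  have "(\<Sum>ys\<in>Poly_Mapping.keys g. scale (Poly_Mapping.lookup f xs * Poly_Mapping.lookup g ys) (shuffle_symb xs ys))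
    = (\<Sum>ys\<in>B. scale (Poly_Mapping.lookup f xs * Poly_Mapping.lookup g ys) (shuffle_symb xs ys))" for xs
    by (rule sum.mono_neutral_left) (use assms in \<open>auto simp: in_keys_iff z\<close>)
  then have "f \<wr> g = (\<Sum>xs\<in>Poly_Mapping.keys f. \<Sum>ys\<in>B.
     scale (Poly_Mapping.lookup f xs * Poly_Mapping.lookup g ys) (shuffle_symb xs ys))"
    by (simp add: shuffle_product_def)
  also have "\<dots> = (\<Sum>xs\<in>A. \<Sum>ys\<in>B.
     scale (Poly_Mapping.lookup f xs * Poly_Mapping.lookup g ys) (shuffle_symb xs ys))"
    by (rule sum.mono_neutral_left) (use assms in \<open>auto simp: in_keys_iff z\<close>)
  finally show ?thesis .
qed

lemma scale_add: "scale (a + b) h = scale a h + scale b h"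
  by (rule poly_mapping_eqI) (simp add: lookup_add algebra_simps)

lemma shuffle_product_add_left: "(f + f') \<wr> g = f \<wr> g + f' \<wr> g"
proof -
  let ?A = "Poly_Mapping.keys f \<union> Poly_Mapping.keys f'" and ?B = "Poly_Mapping.keys g"
  have "Poly_Mapping.keys (f + f') \<subseteq> ?A"
    by (rule Poly_Mapping.keys_add)
  then show ?thesis
    by (simp add: shuffle_product_superset[of ?A ?B] lookup_add distrib_right scale_add sum.distrib)
qed

lemma shuffle_product_add_right: "f \<wr> (g + g') = f \<wr> g + f \<wr> g'"
proof -
  let ?A = "Poly_Mapping.keys f" and ?B = "Poly_Mapping.keys g \<union> Poly_Mapping.keys g'"
  have "Poly_Mapping.keys (g + g') \<subseteq> ?B"
    by (rule Poly_Mapping.keys_add)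
  then show ?thesis
    by (simp add: shuffle_product_superset[of ?A ?B] lookup_add distrib_left scale_add sum.distrib)
qed

lemma keys_scale: "Poly_Mapping.keys (scale c f) \<subseteq> Poly_Mapping.keys f"
  by (auto simp: in_keys_iff)

lemma shuffle_product_scale_left: "scale c f \<wr> g = scale c (f \<wr> g)"
  unfolding shuffle_product_superset[OF finite_keys finite_keys keys_scale order_refl]
  by (rule poly_mapping_eqI) (simp add: shuffle_product_def lookup_sum sum_distrib_left mult.assoc)

lemma shuffle_product_scale_right: "f \<wr> scale c g = scale c (f \<wr> g)"
  unfolding shuffle_product_superset[OF finite_keys finite_keys order_refl keys_scale]
  by (rule poly_mapping_eqI) (simp add: shuffle_product_def lookup_sum sum_distrib_left algebra_simps)


lemma is_matroidD:
  assumes "is_matroid M"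
  shows "finite (ground M)" "indep M {}" "indep M X \<Longrightarrow> X \<subseteq> ground M"
    "indep M X \<Longrightarrow> Y \<subseteq> X \<Longrightarrow> indep M Y"
    "indep M X \<Longrightarrow> indep M Y \<Longrightarrow> card X < card Y \<Longrightarrow> \<exists>x\<in>Y - X. indep M (insert x X)"
  using assms unfolding is_matroid_def by simp_all

lemma is_matroid_direct_sum:
  assumes M1: "is_matroid M1" and M2: "is_matroid M2" and disj: "ground M1 \<inter> ground M2 = {}"
  shows "is_matroid (M1 \<oplus>\<^sub>M M2)"
  unfolding is_matroid_def
proof (intro conjI allI impI)
  show "finite (ground (M1 \<oplus>\<^sub>M M2))"
    using M1 M2 by (simp add: direct_sum_def is_matroid_def)
  show "X \<subseteq> ground (M1 \<oplus>\<^sub>M M2)" if h: "indep (M1 \<oplus>\<^sub>M M2) X" for X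
  proof -
    obtain X1 X2 where "indep M1 X1" "indep M2 X2" "X = X1 \<union> X2"
      using h by (auto simp: direct_sum_def)
    moreover from this have "X1 \<subseteq> ground M1" "X2 \<subseteq> ground M2"
      using is_matroidD(3)[OF M1] is_matroidD(3)[OF M2] by blast+
    ultimately show ?thesis by (auto simp: direct_sum_def)
  qed
  show "indep (M1 \<oplus>\<^sub>M M2) {}"
    using M1 M2 by (auto simp add: direct_sum_def is_matroid_def)
  show "indep (M1 \<oplus>\<^sub>M M2) Y" if h: "indep (M1 \<oplus>\<^sub>M M2) X \<and> Y \<subseteq> X" for X Y
  proof -
    obtain X1 X2 where X: "indep M1 X1" "indep M2 X2" "X = X1 \<union> X2"
      using h by (auto simp: direct_sum_def)
    have "indep M1 (Y \<inter> X1)" "indep M2 (Y \<inter> X2)"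
      using is_matroidD(4)[OF M1 X(1)] is_matroidD(4)[OF M2 X(2)] by simp_all
    moreover have "Y = (Y \<inter> X1) \<union> (Y \<inter> X2)" using h X by auto
    ultimately show ?thesis by (auto simp: direct_sum_def)
  qed
  show "\<exists>x\<in>Y - X. indep (M1 \<oplus>\<^sub>M M2) (insert x X)"
    if h: "indep (M1 \<oplus>\<^sub>M M2) X \<and> indep (M1 \<oplus>\<^sub>M M2) Y \<and> card X < card Y" for X Y
  proof -
    obtain X1 X2 where X: "indep M1 X1" "indep M2 X2" "X = X1 \<union> X2"
      using h by (auto simp: direct_sum_def)
    obtain Y1 Y2 where Y: "indep M1 Y1" "indep M2 Y2" "Y = Y1 \<union> Y2"
      using h by (auto simp: direct_sum_def)
    have sub: "X1 \<subseteq> ground M1" "Y1 \<subseteq> ground M1" "X2 \<subseteq> ground M2" "Y2 \<subseteq> ground M2"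
      using is_matroidD(3)[OF M1] is_matroidD(3)[OF M2] X Y by blast+
    have fin: "finite X1" "finite Y1" "finite X2" "finite Y2"
      using sub is_matroidD(1)[OF M1] is_matroidD(1)[OF M2] by (auto intro: finite_subset)
    have "card X = card X1 + card X2" "card Y = card Y1 + card Y2"
      using X Y sub fin disj by (auto intro!: card_Un_disjoint)
    then consider "card X1 < card Y1" | "card X2 < card Y2"
      using h by linarith
    then show ?thesis
    proof cases
      case 1
      then obtain x where x: "x \<in> Y1 - X1" "indep M1 (insert x X1)"
        using is_matroidD(5)[OF M1 X(1) Y(1)] by blast
      have "x \<in> Y - X" using x X Y sub disj by auto
      moreover have "indep (M1 \<oplus>\<^sub>M M2) (insert x X)"
        using x X unfolding direct_sum_def matroid.simps by (metis Un_insert_left)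
      ultimately show ?thesis by blast
    next
      case 2
      then obtain x where x: "x \<in> Y2 - X2" "indep M2 (insert x X2)"
        using is_matroidD(5)[OF M2 X(2) Y(2)] by blast
      have "x \<in> Y - X" using x X Y sub disj by auto
      moreover have "indep (M1 \<oplus>\<^sub>M M2) (insert x X)"
        using x X unfolding direct_sum_def matroid.simps by (metis Un_insert_right)
      ultimately show ?thesis by blast
    qed
  qed
qed

lemma finite_rank_set:
  assumes "is_matroid M"
  shows "finite {card Y |Y. Y \<subseteq> X \<and> indep M Y}"
proof -
  have "{card Y |Y. Y \<subseteq> X \<and> indep M Y} \<subseteq> card ` Pow (ground M)"
    using is_matroidD(3)[OF assms] by blast
  then show ?thesis
    using is_matroidD(1)[OF assms] by (meson finite_Pow_iff finite_imageI finite_subset)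
qed

lemma rank_of_ge:
  assumes "is_matroid M" "Y \<subseteq> X" "indep M Y"
  shows "card Y \<le> rank_of M X"
  unfolding rank_of_def using assms by (auto intro!: Max_ge finite_rank_set)

lemma rank_of_attained:
  assumes "is_matroid M"
  obtains Y where "Y \<subseteq> X" "indep M Y" "card Y = rank_of M X"
proof -
  have "{card Y |Y. Y \<subseteq> X \<and> indep M Y} \<noteq> {}"
    using is_matroidD(2)[OF assms] by blast
  from Max_in[OF finite_rank_set[OF assms] this]
  obtain Y where "Y \<subseteq> X" "indep M Y" "card Y = rank_of M X"
    unfolding rank_of_def by fastforce
  then show ?thesis by (rule that)
qed

lemma rank_of_empty:
  assumes "is_matroid M"
  shows "rank_of M {} = 0"
  using rank_of_attained[OF assms, of "{}"] by fastforce

lemma rank_of_mono: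
  assumes "is_matroid M" "X \<subseteq> X'"
  shows "rank_of M X \<le> rank_of M X'"
  by (metis assms rank_of_attained rank_of_ge subset_trans)

lemma rank_of_insert:
  assumes "is_matroid M"
  shows "rank_of M (insert x X) \<le> rank_of M X + 1"
proof -
  obtain Y where Y: "Y \<subseteq> insert x X" "indep M Y" "card Y = rank_of M (insert x X)"
    using rank_of_attained[OF assms] by blast
  have "indep M (Y - {x})" using is_matroidD(4)[OF assms Y(2)] by blast
  then have "card (Y - {x}) \<le> rank_of M X"
    using Y by (intro rank_of_ge[OF assms]) auto
  moreover have "card Y \<le> card (Y - {x}) + 1"
    by (cases "card Y") (simp_all add: card_Diff_singleton_if)
  ultimately show ?thesis using Y by simp
qed

lemma rank_sequence_eq:
  assumes "is_matroid M"
  shows "rank_sequence M \<pi> =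
    map (\<lambda>j. rank_of M (set (take (Suc j) \<pi>)) - rank_of M (set (take j \<pi>))) [0..<length \<pi>]"
proof -
  have "[1..<length \<pi> + 1] = map Suc [0..<length \<pi>]"
    by (simp add: map_Suc_upt del: upt_Suc)
  then show ?thesis
    unfolding rank_sequence_def
    by (auto simp del: upt_Suc simp: o_def rank_of_empty[OF assms] take_Suc_conv_app_nth)
qed

lemma rank_sequence_in_nr_sequences:
  assumes M: "is_matroid M" and \<pi>: "\<pi> \<in> permutations_of_set (ground M)"
  shows "rank_sequence M \<pi> \<in> nr_sequences (card (ground M)) (rank M)"
proof -
  let ?s = "\<lambda>j. rank_of M (set (take (Suc j) \<pi>)) - rank_of M (set (take j \<pi>))"
  have set: "set \<pi> = ground M" and "distinct \<pi>"
    using \<pi> by (auto simp: permutations_of_set_def)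
  then have len: "length \<pi> = card (ground M)"
    using distinct_card by fastforce
  have step: "rank_of M (set (take j \<pi>)) \<le> rank_of M (set (take (Suc j) \<pi>))"
    "rank_of M (set (take (Suc j) \<pi>)) \<le> rank_of M (set (take j \<pi>)) + 1" if "j < length \<pi>" for j
    using that rank_of_insert[OF M] by (auto simp: take_Suc_conv_app_nth intro!: rank_of_mono[OF M])
  have 01: "set (rank_sequence M \<pi>) \<subseteq> {0, 1}"
    using step by (fastforce simp: rank_sequence_eq[OF M])
  have cnt: "set xs \<subseteq> {0, 1} \<Longrightarrow> count_list xs 1 = sum_list xs" for xs :: "nat list"
    by (induction xs) auto
  have "m \<le> length \<pi> \<Longrightarrow> (\<Sum>j<m. ?s j) = rank_of M (set (take m \<pi>))" for m
  proof (induction m)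
    case (Suc m)
    then show ?case using step(1)[of m] by simp
  qed (simp add: rank_of_empty[OF M])
  then have "sum_list (rank_sequence M \<pi>) = rank M"
    by (simp add: rank_sequence_eq[OF M] interv_sum_list_conv_sum_set_nat atLeast0LessThan rank_def set)
  then show ?thesis
    using 01 cnt len by (simp add: nr_sequences_def rank_sequence_def)
qed

lemma G_space_sum: "(\<And>i. i \<in> A \<Longrightarrow> f i \<in> G_space n r) \<Longrightarrow> sum f A \<in> G_space n r"
  unfolding G_space_def using Poly_Mapping.keys_sum[of f A] by blast

lemma G_invariant_in_G_space:
  assumes "is_matroid M"
  shows "(G_invariant M :: nat list \<Rightarrow>\<^sub>0 'k::field_char_0) \<in> G_space (card (ground M)) (rank M)"
  unfolding G_invariant_def
  by (rule G_space_sum) (use rank_sequence_in_nr_sequences[OF assms] in \<open>auto simp: G_space_def symb_def\<close>)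

end

theory Submission
  imports Defs
begin

text \<open>Every linear ordering of \<open>E1 \<union> E2\<close> is a shuffle of a unique triple consisting of an ordering
  of \<open>E1\<close>, an ordering of \<open>E2\<close> and a set of positions. Since the rank function of the direct sum is
  the sum of the two rank functions, each step of such an ordering changes only the rank of the
  summand that contains the new element, so the rank sequence of the shuffled ordering is the
  shuffle, at the same positions, of the two rank sequences.\<close>

section \<open>Shuffles of lists\<close>

lemma length_sh [simp]: "length (sh xs ys P) = length xs + length ys"
  by (simp add: sh_def del: upt_Suc)

lemma nth_sh:
  assumes "k < length xs + length ys"
  shows "sh xs ys P ! k =
    (if Suc k \<in> P then xs ! card {j \<in> P. j < Suc k} else ys ! card {j \<in> {1..<Suc k}. j \<notin> P})"
  using assms by (simp add: sh_def del: upt_Suc)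

text \<open>\<open>card {j \<in> P. j < Suc k}\<close> counts how many entries of \<open>xs\<close>
  the first \<open>k\<close> places of \<open>sh xs ys P\<close> consume, as positions start at 1.
  Place \<open>Suc k\<close> advances this count exactly if it lies in \<open>P\<close>; the
  companion lemma treats \<open>ys\<close>. Together they drive the inductions over
  prefixes.\<close>

lemma card_less_Suc_Suc:
  assumes "finite P"
  shows "card {j \<in> P. j < Suc (Suc k)} = card {j \<in> P. j < Suc k} + (if Suc k \<in> P then 1 else 0)"
proof -
  have "{j \<in> P. j < Suc (Suc k)} = {j \<in> P. j < Suc k} \<union> (if Suc k \<in> P then {Suc k} else {})"
    by (auto simp: less_Suc_eq)
  then show ?thesis using assms by simp
qed

lemma card_compl_less_Suc_Suc:
  "card {j \<in> {1..<Suc (Suc k)}. j \<notin> P} =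
    card {j \<in> {1..<Suc k}. j \<notin> P} + (if Suc k \<in> P then 0 else 1)"
proof -
  have "{j \<in> {1..<Suc (Suc k)}. j \<notin> P} =
      {j \<in> {1..<Suc k}. j \<notin> P} \<union> (if Suc k \<in> P then {} else {Suc k})"
    by (auto simp: less_Suc_eq)
  then show ?thesis by simp
qed

text \<open>Guarantees that the index at which \<open>sh\<close> reads \<open>xs\<close> is in
  range: \<open>Suc k\<close> itself belongs to \<open>P\<close> but is not counted. The next lemma
  does the same for \<open>ys\<close>.\<close>

lemma card_position_less:
  assumes "finite P" "Suc k \<in> P"
  shows "card {j \<in> P. j < Suc k} < card P"
  using assms by (intro psubset_card_mono) auto

lemma card_compl_position_less:
  assumes "P \<subseteq> {1..m + n}" "card P = m" "k < m + n" "Suc k \<notin> P"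
  shows "card {j \<in> {1..<Suc k}. j \<notin> P} < n"
proof -
  have "card {j \<in> {1..<Suc k}. j \<notin> P} < card ({1..m + n} - P)"
    using assms by (intro psubset_card_mono) auto
  also have "\<dots> = n"
    using assms by (simp add: card_Diff_subset finite_subset[OF assms(1)])
  finally show ?thesis .
qed

text \<open>Induction on \<open>k\<close>: each new place extends exactly one of the two prefixes by
  its next entry. This is the form that rank sequences need, since they only see the sets of initial
  segments.\<close>

lemma set_take_sh:
  assumes P: "P \<subseteq> {1..length xs + length ys}" "card P = length xs"
    and k: "k \<le> length xs + length ys"
  shows "set (take k (sh xs ys P)) = set (take (card {j \<in> P. j < Suc k}) xs) \<union>
    set (take (card {j \<in> {1..<Suc k}. j \<notin> P}) ys)"
  using k
proof (induction k)
  case 0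
  have "{j \<in> P. j < Suc 0} = {}" using P by auto
  then show ?case by simp
next
  case (Suc k)
  have fin: "finite P" using P(1) finite_subset by blast
  show ?case
    using Suc card_position_less[OF fin, of k] card_compl_position_less[OF P, of k] P
    by (simp add: take_Suc_conv_app_nth nth_sh card_less_Suc_Suc[OF fin]
        card_compl_less_Suc_Suc[simplified])
qed

text \<open>A predicate that separates the entries of \<open>xs\<close> from those of
  \<open>ys\<close> undoes the shuffle. Working with prefixes makes the induction on
  \<open>k\<close> possible.\<close>

lemma filter_take_sh:
  assumes P: "P \<subseteq> {1..length xs + length ys}" "card P = length xs"
    and Q: "\<And>x. x \<in> set xs \<Longrightarrow> Q x" "\<And>y. y \<in> set ys \<Longrightarrow> \<not> Q y"
    and k: "k \<le> length xs + length ys"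
  shows "filter Q (take k (sh xs ys P)) = take (card {j \<in> P. j < Suc k}) xs" (is ?A)
    and "filter (\<lambda>x. \<not> Q x) (take k (sh xs ys P)) =
      take (card {j \<in> {1..<Suc k}. j \<notin> P}) ys" (is ?B)
proof -
  have fin: "finite P" using P(1) finite_subset by blast
  have "?A \<and> ?B"
    using k
  proof (induction k)
    case 0
    have "{j \<in> P. j < Suc 0} = {}" using P by auto
    then show ?case by simp
  next
    case (Suc k)
    show ?case
      using Suc card_position_less[OF fin, of k] card_compl_position_less[OF P, of k] P Q
      by (simp add: take_Suc_conv_app_nth nth_sh card_less_Suc_Suc[OF fin]
        card_compl_less_Suc_Suc[simplified])
  qed
  then show ?A ?B by blast+
qed

text \<open>At full length both lists are used up, which turns the prefix lemmas into statements
  about the whole shuffle.\<close>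

lemma
  assumes P: "P \<subseteq> {1..length xs + length ys}" "card P = length xs"
  shows card_positions_below: "card {j \<in> P. j < Suc (length xs + length ys)} = length xs"
    and card_compl_positions_below:
      "card {j \<in> {1..<Suc (length xs + length ys)}. j \<notin> P} = length ys"
proof -
  have "{j \<in> P. j < Suc (length xs + length ys)} = P"
    "{j \<in> {1..<Suc (length xs + length ys)}. j \<notin> P} = {1..length xs + length ys} - P"
    using P by auto
  then show "card {j \<in> P. j < Suc (length xs + length ys)} = length xs"
    and "card {j \<in> {1..<Suc (length xs + length ys)}. j \<notin> P} = length ys"
    using P by (simp_all add: card_Diff_subset finite_subset[OF P(1)])
qed

lemma set_sh:
  assumes P: "P \<subseteq> {1..length xs + length ys}" "card P = length xs"
  shows "set (sh xs ys P) = set xs \<union> set ys"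
  using set_take_sh[OF P order_refl]
  unfolding card_positions_below[OF P] card_compl_positions_below[OF P] by simp

lemma filter_sh:
  assumes P: "P \<subseteq> {1..length xs + length ys}" "card P = length xs"
    and Q: "\<And>x. x \<in> set xs \<Longrightarrow> Q x" "\<And>y. y \<in> set ys \<Longrightarrow> \<not> Q y"
  shows "filter Q (sh xs ys P) = xs" "filter (\<lambda>x. \<not> Q x) (sh xs ys P) = ys"
  using filter_take_sh[OF P Q order_refl]
  unfolding card_positions_below[OF P] card_compl_positions_below[OF P] by simp_all

text \<open>Positions are shifted by \<open>Suc\<close> to match the convention of
  \<open>sh\<close>, which counts from 1 while list indices count from 0.\<close>

definition positions :: "('b \<Rightarrow> bool) \<Rightarrow> 'b list \<Rightarrow> nat set" where
  "positions Q zs = Suc ` {i. i < length zs \<and> Q (zs ! i)}"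

lemma positions_subset: "positions Q zs \<subseteq> {1..length zs}"
  by (auto simp: positions_def)

lemma card_positions: "card (positions Q zs) = length (filter Q zs)"
  by (simp add: positions_def card_image length_filter_conv_card)

lemma positions_sh:
  assumes P: "P \<subseteq> {1..length xs + length ys}" "card P = length xs"
    and Q: "\<And>x. x \<in> set xs \<Longrightarrow> Q x" "\<And>y. y \<in> set ys \<Longrightarrow> \<not> Q y"
  shows "positions Q (sh xs ys P) = P"
proof -
  have fin: "finite P" using P(1) finite_subset by blast
  \<comment> \<open>\<open>Q\<close> is known only on actual entries of \<open>xs\<close> and
    \<open>ys\<close>, so the bounds on the two indices are what decides it here.\<close>
  have mem: "Q (sh xs ys P ! k) \<longleftrightarrow> Suc k \<in> P" if "k < length xs + length ys" for k
    using that card_position_less[OF fin, of k] card_compl_position_less[OF P that] P Q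
    by (simp add: nth_sh)
  show ?thesis
  proof (intro set_eqI iffI)
    fix i assume "i \<in> P"
    moreover from this obtain k where "i = Suc k" "k < length xs + length ys"
      using P(1) by (cases i) auto
    ultimately show "i \<in> positions Q (sh xs ys P)"
      using mem by (auto simp: positions_def)
  qed (auto simp: positions_def mem)
qed

text \<open>Cut \<open>zs\<close> at \<open>i\<close>: the filtered initial segment has as many
  entries as there are earlier indices satisfying \<open>Q\<close>, and \<open>zs ! i\<close> comes
  right after it.\<close>

lemma nth_filter_card:
  assumes "i < length zs" "Q (zs ! i)"
  shows "filter Q zs ! card {j. j < i \<and> Q (zs ! j)} = zs ! i"
proof -
  have "{j. j < length (take i zs) \<and> Q (take i zs ! j)} = {j. j < i \<and> Q (zs ! j)}"
    using assms by auto
  then have "length (filter Q (take i zs)) = card {j. j < i \<and> Q (zs ! j)}"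
    by (simp only: length_filter_conv_card)
  moreover have "filter Q zs = filter Q (take i zs) @ zs ! i # filter Q (drop (Suc i) zs)"
    using assms by (subst id_take_nth_drop[of i zs]) simp_all
  ultimately show ?thesis by (metis nth_append_length)
qed

text \<open>The converse of \<open>filter_sh\<close> and \<open>positions_sh\<close>: splitting by a
  predicate and shuffling back gives the original list. At each place the counts in
  \<open>sh\<close> become the numbers of earlier entries that satisfy or violate \<open>Q\<close>,
  so \<open>nth_filter_card\<close> applies.\<close>

lemma sh_filter:
  "sh (filter Q zs) (filter (\<lambda>x. \<not> Q x) zs) (positions Q zs) = zs"
proof (rule nth_equalityI)
  show len: "length (sh (filter Q zs) (filter (\<lambda>x. \<not> Q x) zs) (positions Q zs)) = length zs"
    by (simp add: sum_length_filter_compl)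
  fix i assume "i < length (sh (filter Q zs) (filter (\<lambda>x. \<not> Q x) zs) (positions Q zs))"
  then have i: "i < length zs" unfolding len .
  have mem: "Suc i \<in> positions Q zs \<longleftrightarrow> Q (zs ! i)" using i by (auto simp: positions_def)
  have "{j \<in> positions Q zs. j < Suc i} = Suc ` {j. j < i \<and> Q (zs ! j)}"
    using i by (auto simp: positions_def)
  then have c1: "card {j \<in> positions Q zs. j < Suc i} = card {j. j < i \<and> Q (zs ! j)}"
    by (simp add: card_image)
  have "{j \<in> {1..<Suc i}. j \<notin> positions Q zs} = Suc ` {j. j < i \<and> \<not> Q (zs ! j)}"
  proof (intro set_eqI iffI)
    fix j assume "j \<in> {j \<in> {1..<Suc i}. j \<notin> positions Q zs}"
    then show "j \<in> Suc ` {j. j < i \<and> \<not> Q (zs ! j)}"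
      using i by (cases j) (auto simp: positions_def)
  qed (use i in \<open>auto simp: positions_def\<close>)
  then have c2: "card {j \<in> {1..<Suc i}. j \<notin> positions Q zs} = card {j. j < i \<and> \<not> Q (zs ! j)}"
    by (simp add: card_image)
  have "i < length (filter Q zs) + length (filter (\<lambda>x. \<not> Q x) zs)"
    using i by (simp add: sum_length_filter_compl)
  then show "sh (filter Q zs) (filter (\<lambda>x. \<not> Q x) zs) (positions Q zs) ! i = zs ! i"
    unfolding nth_sh[OF \<open>i < length (filter Q zs) + _\<close>] mem c1 c2
    using nth_filter_card[of i zs Q] nth_filter_card[of i zs "\<lambda>x. \<not> Q x"] i by simp
qed

section \<open>Ranks in a direct sum\<close>

lemma rank_of_direct_sum:
  assumes M1: "is_matroid M1" and M2: "is_matroid M2" and disj: "ground M1 \<inter> ground M2 = {}"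
    and A: "A \<subseteq> ground M1" and B: "B \<subseteq> ground M2"
  shows "rank_of (M1 \<oplus>\<^sub>M M2) (A \<union> B) = rank_of M1 A + rank_of M2 B"
proof (rule antisym)
  note M = is_matroid_direct_sum[OF M1 M2 disj]
  have card_Un: "card (Y1 \<union> Y2) = card Y1 + card Y2" if "indep M1 Y1" "indep M2 Y2" for Y1 Y2
  proof (rule card_Un_disjoint)
    have "Y1 \<subseteq> ground M1" "Y2 \<subseteq> ground M2"
      using is_matroidD(3)[OF M1] is_matroidD(3)[OF M2] that by blast+
    then show "finite Y1" "finite Y2" "Y1 \<inter> Y2 = {}"
      using is_matroidD(1)[OF M1] is_matroidD(1)[OF M2] disj by (auto intro: finite_subset)
  qed
  obtain Y where Y: "Y \<subseteq> A \<union> B" "indep (M1 \<oplus>\<^sub>M M2) Y"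
    "card Y = rank_of (M1 \<oplus>\<^sub>M M2) (A \<union> B)"
    using rank_of_attained[OF M] by blast
  then obtain Y1 Y2 where Y12: "indep M1 Y1" "indep M2 Y2" "Y = Y1 \<union> Y2"
    by (auto simp: direct_sum_def)
  have "Y1 \<subseteq> ground M1" "Y2 \<subseteq> ground M2"
    using is_matroidD(3)[OF M1] is_matroidD(3)[OF M2] Y12 by blast+
  \<comment> \<open>An element of \<open>Y1\<close> lies in \<open>A \<union> B\<close> and in
    \<open>ground M1\<close>, hence not in \<open>B\<close>; likewise \<open>Y2\<close> avoids
    \<open>A\<close>.\<close>
  then have "Y1 \<subseteq> A" "Y2 \<subseteq> B" using A B Y(1) Y12(3) disj by blast+
  then show "rank_of (M1 \<oplus>\<^sub>M M2) (A \<union> B) \<le> rank_of M1 A + rank_of M2 B"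
    using rank_of_ge[OF M1 _ Y12(1)] rank_of_ge[OF M2 _ Y12(2)] card_Un[OF Y12(1,2)] Y Y12(3)
    by (metis add_mono)
  obtain X1 where X1: "X1 \<subseteq> A" "indep M1 X1" "card X1 = rank_of M1 A"
    using rank_of_attained[OF M1] by blast
  obtain X2 where X2: "X2 \<subseteq> B" "indep M2 X2" "card X2 = rank_of M2 B"
    using rank_of_attained[OF M2] by blast
  have "indep (M1 \<oplus>\<^sub>M M2) (X1 \<union> X2)"
    using X1 X2 by (auto simp: direct_sum_def)
  then have "card (X1 \<union> X2) \<le> rank_of (M1 \<oplus>\<^sub>M M2) (A \<union> B)"
    using X1 X2 by (intro rank_of_ge[OF M]) auto
  then show "rank_of M1 A + rank_of M2 B \<le> rank_of (M1 \<oplus>\<^sub>M M2) (A \<union> B)"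
    using card_Un[OF X1(2) X2(2)] X1 X2 by simp
qed

lemma length_rank_sequence [simp]: "length (rank_sequence M \<pi>) = length \<pi>"
  by (simp add: rank_sequence_def del: upt_Suc)

lemma nth_rank_sequence:
  assumes "is_matroid M" "k < length \<pi>"
  shows "rank_sequence M \<pi> ! k =
    rank_of M (set (take (Suc k) \<pi>)) - rank_of M (set (take k \<pi>))"
  using assms by (simp add: rank_sequence_eq)

text \<open>By additivity of rank, each prefix of the shuffle has rank a sum of two prefix ranks.
  The next place lengthens only one of the prefixes, so the other rank cancels in the difference and
  the entry of a single summand's rank sequence remains.\<close>

lemma rank_sequence_sh:
  assumes M1: "is_matroid M1" and M2: "is_matroid M2" and disj: "ground M1 \<inter> ground M2 = {}"
    and xs: "set xs \<subseteq> ground M1" and ys: "set ys \<subseteq> ground M2"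
    and P: "P \<subseteq> {1..length xs + length ys}" "card P = length xs"
  shows "rank_sequence (M1 \<oplus>\<^sub>M M2) (sh xs ys P) = sh (rank_sequence M1 xs) (rank_sequence M2 ys) P"
proof (rule nth_equalityI)
  note M = is_matroid_direct_sum[OF M1 M2 disj]
  have fin: "finite P" using P(1) finite_subset by blast
  show "length (rank_sequence (M1 \<oplus>\<^sub>M M2) (sh xs ys P)) =
      length (sh (rank_sequence M1 xs) (rank_sequence M2 ys) P)"
    by simp
  fix k assume "k < length (rank_sequence (M1 \<oplus>\<^sub>M M2) (sh xs ys P))"
  then have k: "k < length xs + length ys" by simp
  have rk: "rank_of (M1 \<oplus>\<^sub>M M2) (set (take l (sh xs ys P))) =
      rank_of M1 (set (take (card {j \<in> P. j < Suc l}) xs)) +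
      rank_of M2 (set (take (card {j \<in> {1..<Suc l}. j \<notin> P}) ys))"
    if "l \<le> length xs + length ys" for l
    unfolding set_take_sh[OF P that]
    by (rule rank_of_direct_sum[OF M1 M2 disj]) (use xs ys set_take_subset in fast)+
  show "rank_sequence (M1 \<oplus>\<^sub>M M2) (sh xs ys P) ! k =
      sh (rank_sequence M1 xs) (rank_sequence M2 ys) P ! k"
    using k card_position_less[OF fin, of k] card_compl_position_less[OF P k] P
    by (simp add: nth_rank_sequence[OF M] nth_rank_sequence[OF M1] nth_rank_sequence[OF M2] rk
        nth_sh card_less_Suc_Suc[OF fin]
        card_compl_less_Suc_Suc[simplified])
qed

section \<open>The shuffle product\<close>

text \<open>Additivity extends to sums once \<open>0 \<wr> g = 0\<close> is known; this is immediate
  from the definition, because \<open>0\<close> has no keys.\<close>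

lemma shuffle_product_sum_left: "sum f A \<wr> g = (\<Sum>a\<in>A. f a \<wr> g)"
  using sum_comp_morphism[of "\<lambda>h. h \<wr> g" f A]
  by (simp add: shuffle_product_add_left o_def) (simp add: shuffle_product_def)

lemma shuffle_product_sum_right: "f \<wr> sum g A = (\<Sum>a\<in>A. f \<wr> g a)"
  using sum_comp_morphism[of "\<lambda>h. f \<wr> h" g A]
  by (simp add: shuffle_product_add_right o_def) (simp add: shuffle_product_def)

section \<open>Reindexing linear orderings of a disjoint union by shuffles\<close>

lemma sum_permutations_of_set_Un:
  assumes "finite A" "finite B" "A \<inter> B = {}"
  shows "(\<Sum>\<pi>\<in>permutations_of_set (A \<union> B). f \<pi>) =
    (\<Sum>xs\<in>permutations_of_set A. \<Sum>ys\<in>permutations_of_set B.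
      \<Sum>P | P \<subseteq> {1..card A + card B} \<and> card P = card A. f (sh xs ys P))"
proof -
  let ?T = "permutations_of_set A \<times> permutations_of_set B \<times>
    {P. P \<subseteq> {1..card A + card B} \<and> card P = card A}"
  have "(\<Sum>(xs, ys, P)\<in>?T. f (sh xs ys P)) = (\<Sum>\<pi>\<in>permutations_of_set (A \<union> B). f \<pi>)"
  \<comment> \<open>Shuffling is inverted by restricting an ordering to \<open>A\<close> and to its
    complement and recording the places occupied by \<open>A\<close>.\<close>
  proof (rule sum.reindex_bij_witness[where
        i = "\<lambda>\<pi>. (filter (\<lambda>x. x \<in> A) \<pi>, filter (\<lambda>x. x \<notin> A) \<pi>, positions (\<lambda>x. x \<in> A) \<pi>)" and
        j = "\<lambda>(xs, ys, P). sh xs ys P"])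
    fix t assume "t \<in> ?T"
    then obtain xs ys P where t: "t = (xs, ys, P)" "set xs = A" "distinct xs" "set ys = B"
        "distinct ys" "P \<subseteq> {1..card A + card B}" "card P = card A"
      by (auto simp: permutations_of_set_def)
    then have len: "length xs = card A" "length ys = card B"
      using distinct_card by metis+
    then have P: "P \<subseteq> {1..length xs + length ys}" "card P = length xs"
      using t by simp_all
    have Q: "\<And>x. x \<in> set xs \<Longrightarrow> x \<in> A" "\<And>y. y \<in> set ys \<Longrightarrow> y \<notin> A"
      using t assms by auto
    show "(\<lambda>\<pi>. (filter (\<lambda>x. x \<in> A) \<pi>, filter (\<lambda>x. x \<notin> A) \<pi>, positions (\<lambda>x. x \<in> A) \<pi>))
        (case t of (xs, ys, P) \<Rightarrow> sh xs ys P) = t"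
      using filter_sh[OF P Q] positions_sh[OF P Q] t(1) by simp
    have "set (sh xs ys P) = A \<union> B"
      using set_sh[OF P] t by simp
    \<comment> \<open>The list has length \<open>card A + card B\<close>, the cardinality of its set
      of entries, so nothing repeats.\<close>
    moreover have "distinct (sh xs ys P)"
      using assms len by (intro card_distinct) (simp add: set_sh[OF P] t card_Un_disjoint)
    ultimately show "(case t of (xs, ys, P) \<Rightarrow> sh xs ys P) \<in> permutations_of_set (A \<union> B)"
      using t(1) by (simp add: permutations_of_set_def)
    show "f (case t of (xs, ys, P) \<Rightarrow> sh xs ys P) = (case t of (xs, ys, P) \<Rightarrow> f (sh xs ys P))"
      using t(1) by simp
  next
    fix \<pi> assume "\<pi> \<in> permutations_of_set (A \<union> B)"
    then have \<pi>: "set \<pi> = A \<union> B" "distinct \<pi>" by (auto simp: permutations_of_set_def)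
    have perm: "filter (\<lambda>x. x \<in> A) \<pi> \<in> permutations_of_set A"
      "filter (\<lambda>x. x \<notin> A) \<pi> \<in> permutations_of_set B"
      using \<pi> assms by (auto simp: permutations_of_set_def)
    have "length \<pi> = card A + card B"
      using \<pi> assms by (metis card_Un_disjoint distinct_card)
    then show "(filter (\<lambda>x. x \<in> A) \<pi>, filter (\<lambda>x. x \<notin> A) \<pi>, positions (\<lambda>x. x \<in> A) \<pi>) \<in> ?T"
      using perm positions_subset[of "\<lambda>x. x \<in> A" \<pi>] card_positions[of "\<lambda>x. x \<in> A" \<pi>]
        length_finite_permutations_of_set[OF perm(1)] by simp
    show "(case (filter (\<lambda>x. x \<in> A) \<pi>, filter (\<lambda>x. x \<notin> A) \<pi>, positions (\<lambda>x. x \<in> A) \<pi>) of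
        (xs, ys, P) \<Rightarrow> sh xs ys P) = \<pi>"
      using sh_filter[of "\<lambda>x. x \<in> A" \<pi>] by simp
  qed
  then show ?thesis by (simp add: sum.cartesian_product)
qed

theorem proposition4p3:
  fixes M1 M2 :: "'a matroid"
  assumes "is_matroid M1" and "is_matroid M2"
    and "ground M1 \<inter> ground M2 = {}"
  shows "(G_invariant (M1 \<oplus>\<^sub>M M2) :: nat list \<Rightarrow>\<^sub>0 'k::field_char_0) = G_invariant M1 \<wr> G_invariant M2"
proof -
  let ?E1 = "ground M1" and ?E2 = "ground M2"
  have fin: "finite ?E1" "finite ?E2"
    using assms is_matroidD(1) by auto
  have "(G_invariant (M1 \<oplus>\<^sub>M M2) :: nat list \<Rightarrow>\<^sub>0 'k) =
      (\<Sum>\<pi>\<in>permutations_of_set (?E1 \<union> ?E2). symb (rank_sequence (M1 \<oplus>\<^sub>M M2) \<pi>))"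
    by (simp add: G_invariant_def direct_sum_def)
  also have "\<dots> = (\<Sum>xs\<in>permutations_of_set ?E1. \<Sum>ys\<in>permutations_of_set ?E2.
      \<Sum>P | P \<subseteq> {1..card ?E1 + card ?E2} \<and> card P = card ?E1.
        symb (rank_sequence (M1 \<oplus>\<^sub>M M2) (sh xs ys P)))"
    by (rule sum_permutations_of_set_Un[OF fin assms(3)])
  also have "\<dots> = (\<Sum>xs\<in>permutations_of_set ?E1. \<Sum>ys\<in>permutations_of_set ?E2.
      shuffle_symb (rank_sequence M1 xs) (rank_sequence M2 ys))"
  proof (intro sum.cong refl)
    fix xs ys assume "xs \<in> permutations_of_set ?E1" "ys \<in> permutations_of_set ?E2"
    then have "set xs = ?E1" "set ys = ?E2" "length xs = card ?E1" "length ys = card ?E2"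
      using length_finite_permutations_of_set by (auto simp: permutations_of_set_def)
    then show "(\<Sum>P | P \<subseteq> {1..card ?E1 + card ?E2} \<and> card P = card ?E1.
          symb (rank_sequence (M1 \<oplus>\<^sub>M M2) (sh xs ys P)) :: nat list \<Rightarrow>\<^sub>0 'k) =
        shuffle_symb (rank_sequence M1 xs) (rank_sequence M2 ys)"
      by (auto simp: shuffle_symb_def intro!: sum.cong arg_cong[of _ _ symb]
          rank_sequence_sh[OF assms])
  qed
  \<comment> \<open>Both invariants are sums of symbols, so expanding the product in each argument
    leaves products of two symbols.\<close>
  also have "\<dots> = G_invariant M1 \<wr> G_invariant M2"
    by (simp only: G_invariant_def shuffle_product_sum_left)
      (simp only: shuffle_product_sum_right shuffle_product_symb)
  finally show ?thesis .
qed

end
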